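(* Let $\Gamma \cup \{\varphi\}$ be a set of formulas over $\Sigma_\omega=\{\land,\vee,\to,\neg\}$. The following assertions are equivalent: (1) $\Gamma \vdash_{C_\omega^+} \varphi$; (2) $\Gamma \models_{\mathbb{HC}_\omega^+} \varphi$; (3) $\Gamma \models_{C_\omega^+}^{HSW} \varphi$.
   Context: Formulas: $For(\Sigma_\omega)$ is the free algebra over the signature $\Sigma_\omega=\{\land,\vee,\to,\neg\}$ ($\land,\vee,\to$ binary, $\neg$ unary) generated by denumerably many propositional variables $p_0,p_1,\dots$. Logic $C_\omega^+$: $\Gamma\vdash_{C_\omega^+}\varphi$ denotes derivability from $\Gamma$ in the Hilbert calculus with the single rule modus ponens and the axiom schemas: $\alpha\to(\beta\to\alpha)$; $(\alpha\to(\beta\to\gamma))\to((\alpha\to\beta)\to(\alpha\to\gamma))$; $\alpha\to(\beta\to(\alpha\land\beta))$; $(\alpha\land\beta)\to\alpha$; $(\alpha\land\beta)\to\beta$; $\alpha\to(\alpha\vee\beta)$; $\beta\to(\alpha\vee\beta)$; $(\alpha\to\gamma)\to((\beta\to\gamma)\to((\alpha\vee\beta)\to\gamma))$; $\alpha\vee\neg\alpha$; $\neg\neg\alpha\to\alpha$ (these define $C_\omega$); and, additionally, $\alpha\to\neg\neg\alpha$. Prosets: a proset is a non-empty set $P$ with a reflexive transitive relation $\preceq$. Write $x\equiv y$ if $x\preceq y$ and $y\preceq x$. For $A,B\subseteq P$: $A\preceq B$ means $a\preceq b$ for all $a\in A,b\in B$ (similarly with an element in place of a set); $A\equiv B$ means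 $a\equiv b$ for all $a\in A,b\in B$. $\mathsf{Min}(B)=\{x\in B: x\preceq B\}$, $\mathsf{Max}(B)=\{x\in B: B\preceq x\}$; $\mathsf{Ub}(B)$, $\mathsf{Lb}(B)$ are the sets of upper and lower bounds of $B$ in $P$; $\top=\mathsf{Max}(P)$. Hyperoperations: an $n$-ary hyperoperation on $A$ is a map $A^n\to\wp(A)\setminus\{\emptyset\}$; a hyperalgebra over a signature is a set with a hyperoperation for each symbol. Hyperlattice: a proset in which $x\curlyvee y:=\mathsf{Min}(\mathsf{Ub}(\{x,y\}))$ and $x\curlywedge y:=\mathsf{Max}(\mathsf{Lb}(\{x,y\}))$ are non-empty for all $x,y$. A Sette implicative hyperlattice (IHL) is a hyperalgebra $\mathsf L=\langle L,\curlywedge,\curlyvee,\multimap\rangle$ such that $\langle L,\curlywedge,\curlyvee\rangle$ is a hyperlattice and, for all $x,y,z,z'$: $z\in x\multimap y$ implies $x\curlywedge z\preceq y$; $x\curlywedge z\preceq y$ implies $z\preceq x\multimap y$; $z\equiv z'$ and $z\in x\multimap y$ imply $z'\in x\multimap y$. HC$_\omega^+$A (hyper $C_\omega^+$ algebra): a hyperalgebra $\mathsf H=\langle H,\curlywedge,\curlyvee,\multimap,\div\rangle$ over $\Sigma_\omega$ (with $\land,\vee,\to,\neg$ interpreted as $\curlywedge,\curlyvee,\multimap,\div$) whose reduct $\langle H,\curlywedge,\curlyvee,\multimap\rangle$ is an IHL and such that for all $x,y,w$: if $y\in\div x$ and $w\in x\curlyvee y$ then $w\in\top$; if $y\in\div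 x$ and $w\in\div y$ then $w\equiv x$. Nmatrices: an Nmatrix is a pair $\mathcal M=\langle\mathsf A,D\rangle$ with $\mathsf A$ a hyperalgebra over $\Sigma_\omega$ and $D\subseteq A$ the designated values. A valuation over $\mathcal M$ is a map $v:For(\Sigma_\omega)\to A$ with $v(\alpha\,\#\,\beta)\in v(\alpha)\,\tilde\#\,v(\beta)$ for each binary $\#$, and $v(\neg\alpha)\in\tilde\neg v(\alpha)$, where $\tilde\#,\tilde\neg$ are the interpretations in $\mathsf A$. $\Gamma\models_{\mathcal M}\varphi$ means: for every valuation $v$, if $v(\gamma)\in D$ for all $\gamma\in\Gamma$ then $v(\varphi)\in D$. $\Gamma\models_{\mathbb{HC}_\omega^+}\varphi$ means $\Gamma\models_{\langle\mathsf H,\top\rangle}\varphi$ for every HC$_\omega^+$A $\mathsf H$, where $\top=\mathsf{Max}(H)$. Hyper swap structures for $C_\omega^+$: for an IHL $\mathsf L$, let $S^{C_\omega}_{\mathsf L}=\{z=(z_1,z_2)\in L\times L: z_1\curlyvee z_2\equiv\top\}$, and let $\mathsf S^+(\mathsf L)$ be the hyperalgebra with domain $S^{C_\omega}_{\mathsf L}$ and $z\curlywedge w=\{u: u_1\in z_1\curlywedge w_1\}$, $z\curlyvee w=\{u: u_1\in z_1\curlyvee w_1\}$, $z\multimap w=\{u: u_1\in z_1\multimap w_1\}$, and negation $\bar\div z=\{u: u_1=z_2\text{ and }u_2\equiv z_1\}$ ($u$ ranging over $S^{C_\omega}_{\mathsf L}$). Its associated Nmatrix is $\langle\mathsf S^+(\mathsf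 L),D^{C_\omega}_{\mathsf L}\rangle$ with $D^{C_\omega}_{\mathsf L}=\{z\in S^{C_\omega}_{\mathsf L}: z_1\in\top\}$. $\Gamma\models_{C_\omega^+}^{HSW}\varphi$ means that $\varphi$ is a consequence of $\Gamma$ in this Nmatrix for every IHL $\mathsf L$. *)

theory Defs
  imports Main
begin

section \<open>Formulas and the calculus\<close>

datatype fm =
    Var nat
  | And fm fm
  | Or fm fm
  | Imp fm fm
  | Neg fm

inductive Cw_axiom :: "fm \<Rightarrow> bool" where
  "Cw_axiom (Imp a (Imp b a))"
| "Cw_axiom (Imp (Imp a (Imp b c)) (Imp (Imp a b) (Imp a c)))"
| "Cw_axiom (Imp a (Imp b (And a b)))"
| "Cw_axiom (Imp (And a b) a)"
| "Cw_axiom (Imp (And a b) b)"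
| "Cw_axiom (Imp a (Or a b))"
| "Cw_axiom (Imp b (Or a b))"
| "Cw_axiom (Imp (Imp a c) (Imp (Imp b c) (Imp (Or a b) c)))"
| "Cw_axiom (Or a (Neg a))"
| "Cw_axiom (Imp (Neg (Neg a)) a)"

inductive Cwp_axiom :: "fm \<Rightarrow> bool" where
  "Cw_axiom a \<Longrightarrow> Cwp_axiom a"
| "Cwp_axiom (Imp a (Neg (Neg a)))"

inductive Cwp_derives :: "fm set \<Rightarrow> fm \<Rightarrow> bool" (infix \<open>\<turnstile>\<close> 50) for \<Gamma> :: "fm set" where
  premise: "a \<in> \<Gamma> \<Longrightarrow> \<Gamma> \<turnstile> a"
| axiom_instance: "Cwp_axiom a \<Longrightarrow> \<Gamma> \<turnstile> a"
| modus_ponens: "\<Gamma> \<turnstile> a \<Longrightarrow> \<Gamma> \<turnstile> Imp a b \<Longrightarrow> \<Gamma> \<turnstile> b"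


section \<open>Prosets\<close>

text \<open>
  A proset is a carrier \<open>P\<close> together with a relation \<open>r\<close> such that \<open>P \<noteq> {}\<close> and
  \<^term>\<open>preorder_on P r\<close>; \<open>(x, y) \<in> r\<close> stands for \<open>x \<preceq> y\<close>.
\<close>

definition equiv_el :: "('a \<times> 'a) set \<Rightarrow> 'a \<Rightarrow> 'a \<Rightarrow> bool" where
  "equiv_el r x y \<longleftrightarrow> (x, y) \<in> r \<and> (y, x) \<in> r"

definition le_set :: "('a \<times> 'a) set \<Rightarrow> 'a set \<Rightarrow> 'a set \<Rightarrow> bool" where
  "le_set r A B \<longleftrightarrow> (\<forall>a\<in>A. \<forall>b\<in>B. (a, b) \<in> r)"

definition equiv_set :: "('a \<times> 'a) set \<Rightarrow> 'a set \<Rightarrow> 'a set \<Rightarrow> bool" where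
  "equiv_set r A B \<longleftrightarrow> (\<forall>a\<in>A. \<forall>b\<in>B. equiv_el r a b)"

definition mins :: "('a \<times> 'a) set \<Rightarrow> 'a set \<Rightarrow> 'a set" where
  "mins r B = {x \<in> B. le_set r {x} B}"

definition maxs :: "('a \<times> 'a) set \<Rightarrow> 'a set \<Rightarrow> 'a set" where
  "maxs r B = {x \<in> B. le_set r B {x}}"

definition ubs :: "'a set \<Rightarrow> ('a \<times> 'a) set \<Rightarrow> 'a set \<Rightarrow> 'a set" where
  "ubs P r B = {x \<in> P. le_set r B {x}}"

definition lbs :: "'a set \<Rightarrow> ('a \<times> 'a) set \<Rightarrow> 'a set \<Rightarrow> 'a set" where
  "lbs P r B = {x \<in> P. le_set r {x} B}"


section \<open>Hyperalgebras\<close>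

text \<open>
  Hyperoperations are total functions on the ambient type, but only their values on the
  carrier matter.  Since the signature with negation is a record extension, a predicate on the
  smaller record applied to the larger one speaks about its reduct without negation.
\<close>

record 'a hyperalg_pos =
  carrier :: "'a set"
  hconj :: "'a \<Rightarrow> 'a \<Rightarrow> 'a set"
  hdisj :: "'a \<Rightarrow> 'a \<Rightarrow> 'a set"
  himp :: "'a \<Rightarrow> 'a \<Rightarrow> 'a set"

record 'a hyperalg = "'a hyperalg_pos" +
  hneg :: "'a \<Rightarrow> 'a set"

definition hyperop1 :: "'a set \<Rightarrow> ('a \<Rightarrow> 'a set) \<Rightarrow> bool" where
  "hyperop1 A f \<longleftrightarrow> (\<forall>x\<in>A. f x \<subseteq> A \<and> f x \<noteq> {})"

definition hyperop2 :: "'a set \<Rightarrow> ('a \<Rightarrow> 'a \<Rightarrow> 'a set) \<Rightarrow> bool" where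
  "hyperop2 A f \<longleftrightarrow> (\<forall>x\<in>A. \<forall>y\<in>A. f x y \<subseteq> A \<and> f x y \<noteq> {})"

text \<open>
  The preorder is an explicit argument, but it is determined on the carrier by the operations:
  \<open>x \<preceq> y\<close> iff \<open>y \<in> hdisj L x y\<close> (see \<open>hyperlattice_order_iff\<close> below).
\<close>

definition hyperlattice :: "('a \<times> 'a) set \<Rightarrow> ('a, 'm) hyperalg_pos_scheme \<Rightarrow> bool" where
  "hyperlattice r L \<longleftrightarrow>
     carrier L \<noteq> {} \<and> preorder_on (carrier L) r \<and>
     hyperop2 (carrier L) (hconj L) \<and> hyperop2 (carrier L) (hdisj L) \<and>
     (\<forall>x\<in>carrier L. \<forall>y\<in>carrier L.
        hdisj L x y = mins r (ubs (carrier L) r {x, y}) \<and>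
        hconj L x y = maxs r (lbs (carrier L) r {x, y}))"

definition IHL :: "('a \<times> 'a) set \<Rightarrow> ('a, 'm) hyperalg_pos_scheme \<Rightarrow> bool" where
  "IHL r L \<longleftrightarrow>
     hyperlattice r L \<and> hyperop2 (carrier L) (himp L) \<and>
     (\<forall>x\<in>carrier L. \<forall>y\<in>carrier L. \<forall>z\<in>carrier L. \<forall>z'\<in>carrier L.
        (z \<in> himp L x y \<longrightarrow> le_set r (hconj L x z) {y}) \<and>
        (le_set r (hconj L x z) {y} \<longrightarrow> le_set r {z} (himp L x y)) \<and>
        (equiv_el r z z' \<and> z \<in> himp L x y \<longrightarrow> z' \<in> himp L x y))"

abbreviation top_els :: "('a \<times> 'a) set \<Rightarrow> ('a, 'm) hyperalg_pos_scheme \<Rightarrow> 'a set" where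
  "top_els r L \<equiv> maxs r (carrier L)"

definition HCwpA :: "('a \<times> 'a) set \<Rightarrow> ('a, 'm) hyperalg_scheme \<Rightarrow> bool" where
  "HCwpA r H \<longleftrightarrow>
     IHL r H \<and> hyperop1 (carrier H) (hneg H) \<and>
     (\<forall>x\<in>carrier H. \<forall>y\<in>carrier H. \<forall>w\<in>carrier H.
        (y \<in> hneg H x \<and> w \<in> hdisj H x y \<longrightarrow> w \<in> top_els r H) \<and>
        (y \<in> hneg H x \<and> w \<in> hneg H y \<longrightarrow> equiv_el r w x))"


section \<open>Nmatrices\<close>

definition valuation :: "('a, 'm) hyperalg_scheme \<Rightarrow> (fm \<Rightarrow> 'a) \<Rightarrow> bool" where
  "valuation A v \<longleftrightarrow>
     (\<forall>a. v a \<in> carrier A) \<and>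
     (\<forall>a b. v (And a b) \<in> hconj A (v a) (v b)) \<and>
     (\<forall>a b. v (Or a b) \<in> hdisj A (v a) (v b)) \<and>
     (\<forall>a b. v (Imp a b) \<in> himp A (v a) (v b)) \<and>
     (\<forall>a. v (Neg a) \<in> hneg A (v a))"

definition nmatrix_conseq ::
    "('a, 'm) hyperalg_scheme \<Rightarrow> 'a set \<Rightarrow> fm set \<Rightarrow> fm \<Rightarrow> bool" where
  "nmatrix_conseq A D \<Gamma> \<phi> \<longleftrightarrow>
     (\<forall>v. valuation A v \<longrightarrow> (\<forall>\<gamma>\<in>\<Gamma>. v \<gamma> \<in> D) \<longrightarrow> v \<phi> \<in> D)"

text \<open>
  HOL cannot quantify over all types inside a formula, so the consequence relations of a class of
  structures carry a type argument: the structures considered are all those whose carrier is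
  a (finite or infinite) subset of that type.  Over an infinite type this covers, up to
  isomorphism, all finite and denumerable structures; a structure of any given cardinality is
  covered by choosing the type large enough.
\<close>

definition HCwp_conseq :: "'a itself \<Rightarrow> fm set \<Rightarrow> fm \<Rightarrow> bool" where
  "HCwp_conseq (_ :: 'a itself) \<Gamma> \<phi> \<longleftrightarrow>
     (\<forall>r (H :: 'a hyperalg). HCwpA r H \<longrightarrow> nmatrix_conseq H (top_els r H) \<Gamma> \<phi>)"


section \<open>Hyper swap structures\<close>

definition swap_dom :: "('a \<times> 'a) set \<Rightarrow> 'a hyperalg_pos \<Rightarrow> ('a \<times> 'a) set" where
  "swap_dom r L =
     {z \<in> carrier L \<times> carrier L. equiv_set r (hdisj L (fst z) (snd z)) (top_els r L)}"

definition swap_alg :: "('a \<times> 'a) set \<Rightarrow> 'a hyperalg_pos \<Rightarrow> ('a \<times> 'a) hyperalg" where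
  "swap_alg r L =
     \<lparr> carrier = swap_dom r L,
       hconj = (\<lambda>z w. {u \<in> swap_dom r L. fst u \<in> hconj L (fst z) (fst w)}),
       hdisj = (\<lambda>z w. {u \<in> swap_dom r L. fst u \<in> hdisj L (fst z) (fst w)}),
       himp = (\<lambda>z w. {u \<in> swap_dom r L. fst u \<in> himp L (fst z) (fst w)}),
       hneg = (\<lambda>z. {u \<in> swap_dom r L. fst u = snd z \<and> equiv_el r (snd u) (fst z)}) \<rparr>"

definition swap_desig :: "('a \<times> 'a) set \<Rightarrow> 'a hyperalg_pos \<Rightarrow> ('a \<times> 'a) set" where
  "swap_desig r L = {z \<in> swap_dom r L. fst z \<in> top_els r L}"

definition HSW_conseq :: "'a itself \<Rightarrow> fm set \<Rightarrow> fm \<Rightarrow> bool" where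
  "HSW_conseq (_ :: 'a itself) \<Gamma> \<phi> \<longleftrightarrow>
     (\<forall>r (L :: 'a hyperalg_pos). IHL r L \<longrightarrow>
        nmatrix_conseq (swap_alg r L) (swap_desig r L) \<Gamma> \<phi>)"


section \<open>Sanity checks\<close>

lemma hyperlattice_order_iff:
  assumes "hyperlattice r L" "x \<in> carrier L" "y \<in> carrier L"
  shows "(x, y) \<in> r \<longleftrightarrow> y \<in> hdisj L x y"
  using assms
  by (auto simp: hyperlattice_def mins_def ubs_def le_set_def preorder_on_def refl_on_def)

lemma IHL_top_nonempty:
  assumes "IHL r L"
  shows "top_els r L \<noteq> {}"
proof -
  have hl: "hyperlattice r L" and ne: "hyperop2 (carrier L) (himp L)"
    using assms by (auto simp: IHL_def)
  obtain x where x: "x \<in> carrier L" using hl by (auto simp: hyperlattice_def)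
  obtain t where t: "t \<in> himp L x x" "t \<in> carrier L"
    using ne x by (fastforce simp: hyperop2_def)
  have "(z, t) \<in> r" if z: "z \<in> carrier L" for z
  proof -
    have "le_set r (hconj L x z) {x}"
      using hl x z by (auto simp: hyperlattice_def maxs_def lbs_def le_set_def)
    then have "le_set r {z} (himp L x x)" using assms x z unfolding IHL_def by blast
    then show ?thesis using t by (simp add: le_set_def)
  qed
  then show ?thesis using t by (auto simp: maxs_def le_set_def)
qed

lemma swap_alg_hyperops:
  assumes L: "IHL r L"
  defines "S \<equiv> swap_alg r L"
  shows "carrier S \<noteq> {}" "hyperop2 (carrier S) (hconj S)" "hyperop2 (carrier S) (hdisj S)"
    "hyperop2 (carrier S) (himp S)" "hyperop1 (carrier S) (hneg S)"
proof -
  have hl: "hyperlattice r L" using L by (simp add: IHL_def)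
  then have tr: "trans r" and rf: "\<And>x. x \<in> carrier L \<Longrightarrow> (x, x) \<in> r"
    by (auto simp: hyperlattice_def preorder_on_def refl_on_def)
  have dj: "hdisj L x y = mins r (ubs (carrier L) r {x, y})"
    if "x \<in> carrier L" "y \<in> carrier L" for x y
    using hl that by (simp add: hyperlattice_def)
  obtain t where t: "t \<in> carrier L" "\<And>z. z \<in> carrier L \<Longrightarrow> (z, t) \<in> r"
    using IHL_top_nonempty[OF L] by (auto simp: maxs_def le_set_def)
  have pair: "(x, t) \<in> swap_dom r L" if x: "x \<in> carrier L" for x
  proof -
    have "(u, w) \<in> r \<and> (w, u) \<in> r" if "u \<in> hdisj L x t" "w \<in> top_els r L" for u w
    proof -
      have u: "u \<in> carrier L" "(t, u) \<in> r" and w: "w \<in> carrier L" "(u, w) \<in> r"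
        using that dj[OF x t(1)] by (auto simp: mins_def ubs_def maxs_def le_set_def)
      then show ?thesis using t(2)[OF w(1)] transD[OF tr] by blast
    qed
    then show ?thesis using x t(1) by (auto simp: swap_dom_def equiv_set_def equiv_el_def)
  qed
  have swp: "(y, x) \<in> swap_dom r L" if "(x, y) \<in> swap_dom r L" for x y
    using that dj[of x y] dj[of y x] by (auto simp: swap_dom_def insert_commute[of x y])
  have ops: "hyperop2 (swap_dom r L) (\<lambda>z w. {u \<in> swap_dom r L. fst u \<in> f (fst z) (fst w)})"
    if f: "hyperop2 (carrier L) f" for f
    unfolding hyperop2_def
  proof (intro ballI conjI)
    fix z w assume "z \<in> swap_dom r L" "w \<in> swap_dom r L"
    then obtain x where "x \<in> f (fst z) (fst w)" "x \<in> carrier L"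
      using f by (fastforce simp: swap_dom_def hyperop2_def)
    then show "{u \<in> swap_dom r L. fst u \<in> f (fst z) (fst w)} \<noteq> {}"
      using pair by fastforce
  qed auto
  show "carrier S \<noteq> {}" using pair t by (auto simp: S_def swap_alg_def)
  show "hyperop2 (carrier S) (hconj S)" "hyperop2 (carrier S) (hdisj S)"
    "hyperop2 (carrier S) (himp S)"
    using L by (auto simp: S_def swap_alg_def IHL_def hyperlattice_def intro!: ops)
  show "hyperop1 (carrier S) (hneg S)"
    unfolding hyperop1_def
  proof (intro ballI conjI)
    fix z assume z: "z \<in> carrier S"
    then have "(snd z, fst z) \<in> swap_dom r L" "(fst z, fst z) \<in> r"
      using swp rf by (auto simp: S_def swap_alg_def swap_dom_def)
    then show "hneg S z \<noteq> {}"
      by (auto simp: S_def swap_alg_def equiv_el_def)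
  qed (auto simp: S_def swap_alg_def)
qed

end

theory Submission
  imports Defs "HOL-Library.Countable"
begin

text \<open>
  Soundness holds in every HC$_\omega^+$A because the residuum satisfies the Kripke-style clause
  \<open>w \<preceq> x \<multimap> y\<close> iff every \<open>u\<close> below \<open>w\<close> and \<open>x\<close> is below \<open>y\<close>; it carries over to hyper swap structures
  since these are HC$_\omega^+$As for the preorder comparing first components. For completeness, the
  set of formulas preordered by \<open>\<Gamma> \<turnstile> a \<rightarrow> b\<close> is itself an HC$_\omega^+$A when negation is the
  single-valued \<open>{\<not> a}\<close>: a hyperoperation need not respect the induced equivalence, so the failure
  of the replacement property for negation is harmless. The identity is then a refuting
  valuation, and \<open>a \<mapsto> (a, \<not> a)\<close> is one into the swap structure over its positive reduct. An
  injection of the countable set of formulas moves these structures to any infinite type.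
\<close>

subsection \<open>Derivability\<close>

lemma Cw_axiom_derives: "Cw_axiom a \<Longrightarrow> \<Gamma> \<turnstile> a"
  by (intro Cwp_derives.axiom_instance Cwp_axiom.intros)

lemma derives_K: "\<Gamma> \<turnstile> a \<Longrightarrow> \<Gamma> \<turnstile> Imp b a"
  by (meson Cw_axiom.intros(1) Cw_axiom_derives Cwp_derives.modus_ponens)

lemma derives_S: "\<Gamma> \<turnstile> Imp a (Imp b c) \<Longrightarrow> \<Gamma> \<turnstile> Imp a b \<Longrightarrow> \<Gamma> \<turnstile> Imp a c"
  by (meson Cw_axiom.intros(2) Cw_axiom_derives Cwp_derives.modus_ponens)

lemma derives_Imp_refl: "\<Gamma> \<turnstile> Imp a a"
  by (meson Cw_axiom.intros(1) Cw_axiom_derives derives_S)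

lemma derives_mono: "\<Gamma> \<turnstile> a \<Longrightarrow> \<Gamma> \<subseteq> \<Delta> \<Longrightarrow> \<Delta> \<turnstile> a"
  by (induction rule: Cwp_derives.induct) (auto intro: Cwp_derives.intros)

text \<open>By induction on the derivation, the schemas K and S discharge premises, axioms and modus
  ponens. As an equivalence it serves as a rewrite rule trading implications for extra
  premises.\<close>

theorem deduction: "\<Gamma> \<turnstile> Imp a b \<longleftrightarrow> insert a \<Gamma> \<turnstile> b"
proof
  assume "\<Gamma> \<turnstile> Imp a b"
  then have "insert a \<Gamma> \<turnstile> Imp a b" by (rule derives_mono) auto
  then show "insert a \<Gamma> \<turnstile> b" by (meson Cwp_derives.intros insertI1)
next
  assume "insert a \<Gamma> \<turnstile> b"
  then show "\<Gamma> \<turnstile> Imp a b"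
    by (induction rule: Cwp_derives.induct)
      (auto intro: derives_Imp_refl derives_K derives_S Cwp_derives.intros)
qed

lemma derives_And: "\<Gamma> \<turnstile> And a b \<longleftrightarrow> \<Gamma> \<turnstile> a \<and> \<Gamma> \<turnstile> b"
  by (meson Cw_axiom.intros(3-5) Cw_axiom_derives Cwp_derives.modus_ponens)

lemma derives_Imp_trans: "\<Gamma> \<turnstile> Imp a b \<Longrightarrow> \<Gamma> \<turnstile> Imp b c \<Longrightarrow> \<Gamma> \<turnstile> Imp a c"
  by (meson derives_K derives_S)

lemma derives_Imp_And: "\<Gamma> \<turnstile> Imp c (And a b) \<longleftrightarrow> \<Gamma> \<turnstile> Imp c a \<and> \<Gamma> \<turnstile> Imp c b"
  by (simp add: deduction derives_And)

lemma derives_Or_Imp: "\<Gamma> \<turnstile> Imp (Or a b) c \<longleftrightarrow> \<Gamma> \<turnstile> Imp a c \<and> \<Gamma> \<turnstile> Imp b c"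
  by (meson Cw_axiom.intros(6-8) Cw_axiom_derives Cwp_derives.modus_ponens derives_Imp_trans)

text \<open>The premises a and c together have the same consequences as their conjunction. This
  becomes the residuation law of the canonical structure, with the antecedent on the left of the
  conjunction as in the definition of an IHL.\<close>

lemma derives_residuation: "\<Gamma> \<turnstile> Imp c (Imp a b) \<longleftrightarrow> \<Gamma> \<turnstile> Imp (And a c) b"
proof -
  have "insert a (insert c \<Gamma>) \<turnstile> b \<longleftrightarrow> insert (And a c) \<Gamma> \<turnstile> b"
  proof
    assume "insert a (insert c \<Gamma>) \<turnstile> b"
    then have "\<Gamma> \<turnstile> Imp c (Imp a b)" by (simp add: deduction)
    then have *: "insert (And a c) \<Gamma> \<turnstile> Imp c (Imp a b)" by (rule derives_mono) auto
    have "insert (And a c) \<Gamma> \<turnstile> And a c" by (simp add: Cwp_derives.premise)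
    with * show "insert (And a c) \<Gamma> \<turnstile> b"
      by (meson derives_And Cwp_derives.modus_ponens)
  next
    assume "insert (And a c) \<Gamma> \<turnstile> b"
    then have "\<Gamma> \<turnstile> Imp (And a c) b" by (simp add: deduction)
    then have *: "insert a (insert c \<Gamma>) \<turnstile> Imp (And a c) b" by (rule derives_mono) auto
    have "insert a (insert c \<Gamma>) \<turnstile> And a c" by (simp add: Cwp_derives.premise derives_And)
    with * show "insert a (insert c \<Gamma>) \<turnstile> b" by (meson Cwp_derives.modus_ponens)
  qed
  then show ?thesis by (simp add: deduction)
qed

lemma derives_Neg_Neg: "\<Gamma> \<turnstile> Imp (Neg (Neg a)) a" "\<Gamma> \<turnstile> Imp a (Neg (Neg a))"
  by (auto intro: Cw_axiom_derives Cw_axiom.intros Cwp_derives.axiom_instance Cwp_axiom.intros)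

lemma derives_excluded_middle: "\<Gamma> \<turnstile> Or a (Neg a)"
  by (intro Cw_axiom_derives Cw_axiom.intros)


subsection \<open>Soundness\<close>

lemma hyperlattice_refl: "hyperlattice r L \<Longrightarrow> x \<in> carrier L \<Longrightarrow> (x, x) \<in> r"
  by (auto simp: hyperlattice_def preorder_on_def refl_on_def)

lemma hyperlattice_trans: "hyperlattice r L \<Longrightarrow> (x, y) \<in> r \<Longrightarrow> (y, z) \<in> r \<Longrightarrow> (x, z) \<in> r"
  by (auto simp: hyperlattice_def preorder_on_def dest: transD)

lemma hyperlattice_conj_iff:
  assumes "hyperlattice r L" "x \<in> carrier L" "y \<in> carrier L"
  shows "z \<in> hconj L x y \<longleftrightarrow> z \<in> carrier L \<and> (z, x) \<in> r \<and> (z, y) \<in> r \<and>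
    (\<forall>w\<in>carrier L. (w, x) \<in> r \<longrightarrow> (w, y) \<in> r \<longrightarrow> (w, z) \<in> r)"
  using assms by (auto simp: hyperlattice_def maxs_def lbs_def le_set_def)

lemma hyperlattice_disj_iff:
  assumes "hyperlattice r L" "x \<in> carrier L" "y \<in> carrier L"
  shows "z \<in> hdisj L x y \<longleftrightarrow> z \<in> carrier L \<and> (x, z) \<in> r \<and> (y, z) \<in> r \<and>
    (\<forall>w\<in>carrier L. (x, w) \<in> r \<longrightarrow> (y, w) \<in> r \<longrightarrow> (z, w) \<in> r)"
  using assms by (auto simp: hyperlattice_def mins_def ubs_def le_set_def)

text \<open>Left to right, u lies below both x and p, hence below some m in
  \<open>hconj L x p\<close>, and residuation puts m below y. Right to left, the assumption puts all
  of \<open>hconj L x w\<close> below y, so w lies below every residuum. Thus all choices of p have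
  the same elements below them, and the hyperoperation gives way to a pure order condition.\<close>

lemma IHL_imp_below:
  assumes L: "IHL r L" and p: "p \<in> himp L x y"
    and c: "x \<in> carrier L" "y \<in> carrier L" "w \<in> carrier L"
  shows "(w, p) \<in> r \<longleftrightarrow> (\<forall>u\<in>carrier L. (u, w) \<in> r \<longrightarrow> (u, x) \<in> r \<longrightarrow> (u, y) \<in> r)"
proof -
  have hl: "hyperlattice r L" and "hyperop2 (carrier L) (himp L)"
    and res: "\<And>z. z \<in> carrier L \<Longrightarrow> z \<in> himp L x y \<Longrightarrow> le_set r (hconj L x z) {y}"
      "\<And>z. z \<in> carrier L \<Longrightarrow> le_set r (hconj L x z) {y} \<Longrightarrow> le_set r {z} (himp L x y)"
    using L c unfolding IHL_def by blast+
  then have pc: "p \<in> carrier L" using p c by (auto simp: hyperop2_def)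
  have ne: "hconj L x p \<noteq> {}"
    using hl c pc by (auto simp: hyperlattice_def hyperop2_def)
  show ?thesis
  proof (intro iffI ballI impI)
    fix u assume "(w, p) \<in> r" and u: "u \<in> carrier L" "(u, w) \<in> r" "(u, x) \<in> r"
    then have "(u, p) \<in> r" using hyperlattice_trans[OF hl] by blast
    moreover obtain m where m: "m \<in> hconj L x p" using ne by blast
    ultimately have "(u, m) \<in> r" using hyperlattice_conj_iff[OF hl c(1) pc] u by blast
    moreover have "(m, y) \<in> r" using res(1)[OF pc p] m by (simp add: le_set_def)
    ultimately show "(u, y) \<in> r" using hyperlattice_trans[OF hl] by blast
  next
    assume "\<forall>u\<in>carrier L. (u, w) \<in> r \<longrightarrow> (u, x) \<in> r \<longrightarrow> (u, y) \<in> r"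
    then have "le_set r (hconj L x w) {y}"
      using hyperlattice_conj_iff[OF hl c(1,3)] by (auto simp: le_set_def)
    then show "(w, p) \<in> r" using res(2)[OF c(3)] p by (simp add: le_set_def)
  qed
qed

text \<open>Reading \<open>(w, v a) \<in> r\<close> as w forcing a turns implication and conjunction
  into their Kripke clauses, the elements below w being the accessible worlds. The axioms are then
  checked as in intuitionistic Kripke semantics, except where disjunction and negation need the
  algebra.\<close>

lemma HCwpA_valuation_axiom:
  assumes H: "HCwpA r H" and v: "valuation H v" and ax: "Cwp_axiom a" and w: "w \<in> carrier H"
  shows "(w, v a) \<in> r"
proof -
  have L: "IHL r H" and hl: "hyperlattice r H"
    and negdisj: "\<And>x y w. x \<in> carrier H \<Longrightarrow> y \<in> carrier H \<Longrightarrow> w \<in> carrier H \<Longrightarrow> y \<in> hneg H x \<Longrightarrow>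
      w \<in> hdisj H x y \<Longrightarrow> w \<in> top_els r H"
    and negneg: "\<And>x y w. x \<in> carrier H \<Longrightarrow> y \<in> carrier H \<Longrightarrow> w \<in> carrier H \<Longrightarrow> y \<in> hneg H x \<Longrightarrow>
      w \<in> hneg H y \<Longrightarrow> equiv_el r w x"
    using H unfolding HCwpA_def IHL_def by blast+
  have c: "v a \<in> carrier H" for a using v by (simp add: valuation_def)
  have imp: "(w, v (Imp a b)) \<in> r \<longleftrightarrow>
      (\<forall>u\<in>carrier H. (u, w) \<in> r \<longrightarrow> (u, v a) \<in> r \<longrightarrow> (u, v b) \<in> r)" if "w \<in> carrier H" for a b w
    using IHL_imp_below[OF L _ c c that] v by (simp add: valuation_def)
  have con: "(u, v (And a b)) \<in> r \<longleftrightarrow> (u, v a) \<in> r \<and> (u, v b) \<in> r" if "u \<in> carrier H" for a b u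
    using hyperlattice_conj_iff[OF hl c c, of "v (And a b)" a b] v that hyperlattice_trans[OF hl]
    unfolding valuation_def by blast
  have dis: "(v a, v (Or a b)) \<in> r" "(v b, v (Or a b)) \<in> r"
    "\<And>w. w \<in> carrier H \<Longrightarrow> (v a, w) \<in> r \<Longrightarrow> (v b, w) \<in> r \<Longrightarrow> (v (Or a b), w) \<in> r" for a b
    using hyperlattice_disj_iff[OF hl c c, of "v (Or a b)" a b] v
    unfolding valuation_def by blast+
  \<comment> \<open>Elements need not be prime, so forcing a disjunction need not force a disjunct.
    Instead u moves to the antecedent: both disjuncts lie below a residuum p of u and
    \<open>v z\<close>, hence so does u, and the clause for p is evaluated at u itself.\<close>
  have orelim: "(u, v z) \<in> r"
    if u: "u \<in> carrier H" and uac: "(u, v (Imp a z)) \<in> r" and ubc: "(u, v (Imp b z)) \<in> r"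
      and uab: "(u, v (Or a b)) \<in> r" for u a b z
  proof -
    obtain p where p: "p \<in> himp H u (v z)" "p \<in> carrier H"
      using L u c[of z] unfolding IHL_def hyperop2_def by blast
    have "(v a, p) \<in> r" "(v b, p) \<in> r"
      using uac ubc by (auto simp: imp[OF u] IHL_imp_below[OF L p(1) u c c])
    then have "(v (Or a b), p) \<in> r" using dis(3) p by blast
    then have "(u, p) \<in> r" using uab hyperlattice_trans[OF hl] by blast
    then show ?thesis
      using hyperlattice_refl[OF hl u] u by (simp add: IHL_imp_below[OF L p(1) u c u])
  qed
  have em: "(u, v (Or a (Neg a))) \<in> r" if "u \<in> carrier H" for a u
    using negdisj[OF c c c, of "Neg a" a "Or a (Neg a)"] v that
    by (simp add: valuation_def maxs_def le_set_def)
  have nn: "(v (Neg (Neg a)), v a) \<in> r" "(v a, v (Neg (Neg a))) \<in> r" for a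
    using negneg[OF c c c, of "Neg a" a "Neg (Neg a)"] v
    by (simp_all add: valuation_def equiv_el_def)
  note tr = hyperlattice_trans[OF hl]
  \<comment> \<open>\<open>impI\<close> and \<open>impE\<close> now stand for introduction and
    elimination of the object-level implication at an element w, not for the HOL rules.\<close>
  have impI: "(w, v (Imp a b)) \<in> r"
    if "w \<in> carrier H" "\<And>u. u \<in> carrier H \<Longrightarrow> (u, w) \<in> r \<Longrightarrow> (u, v a) \<in> r \<Longrightarrow> (u, v b) \<in> r"
    for a b w
    using imp that by blast
  have impE: "(w, v b) \<in> r" if "w \<in> carrier H" "(w, v (Imp a b)) \<in> r" "(w, v a) \<in> r" for a b w
    using imp that hyperlattice_refl[OF hl] by blast
  from ax show ?thesis
  proof cases
    case 1
    then show ?thesis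
    proof (cases rule: Cw_axiom.cases)
      case (1 a b)
      show ?thesis unfolding 1 by (intro impI w; meson tr)
    next
      case (2 a b c)
      show ?thesis unfolding 2
      proof (intro impI w)
        fix u1 u2 u3 assume u3: "u3 \<in> carrier H"
          and "(u1, v (Imp a (Imp b c))) \<in> r" "(u2, u1) \<in> r" "(u2, v (Imp a b)) \<in> r"
            "(u3, u2) \<in> r" "(u3, v a) \<in> r"
        then have "(u3, v (Imp a (Imp b c))) \<in> r" "(u3, v (Imp a b)) \<in> r" by (blast intro: tr)+
        then show "(u3, v c) \<in> r" using impE u3 \<open>(u3, v a) \<in> r\<close> by blast
      qed
    next
      case (3 a b)
      show ?thesis unfolding 3 by (intro impI w; meson con tr)
    next
      case (4 a b)
      show ?thesis unfolding 4 by (intro impI w) (simp add: con)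
    next
      case (5 a b)
      show ?thesis unfolding 5 by (intro impI w) (simp add: con)
    next
      case (6 a b)
      show ?thesis unfolding 6 by (intro impI w) (meson tr dis)
    next
      case (7 b a)
      show ?thesis unfolding 7 by (intro impI w) (meson tr dis)
    next
      case (8 a c b)
      show ?thesis unfolding 8
      proof (intro impI w)
        fix u1 u2 u3 assume u3: "u3 \<in> carrier H"
          and "(u1, v (Imp a c)) \<in> r" "(u2, u1) \<in> r" "(u2, v (Imp b c)) \<in> r"
            "(u3, u2) \<in> r" and d: "(u3, v (Or a b)) \<in> r"
        then have "(u3, v (Imp a c)) \<in> r" "(u3, v (Imp b c)) \<in> r" by (blast intro: tr)+
        then show "(u3, v c) \<in> r" using orelim u3 d by blast
      qed
    next
      case (9 a)
      show ?thesis unfolding 9 using em w by blast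
    next
      case (10 a)
      show ?thesis unfolding 10 by (intro impI w) (meson tr nn)
    qed
  next
    case (2 a)
    show ?thesis unfolding 2 by (intro impI w) (meson tr nn)
  qed
qed

theorem HCwpA_sound:
  assumes "\<Gamma> \<turnstile> \<phi>" and H: "HCwpA r H"
  shows "nmatrix_conseq H (top_els r H) \<Gamma> \<phi>"
  unfolding nmatrix_conseq_def
proof (intro allI impI)
  fix v assume v: "valuation H v" and pr: "\<forall>\<gamma>\<in>\<Gamma>. v \<gamma> \<in> top_els r H"
  have L: "IHL r H" and hl: "hyperlattice r H" using H unfolding HCwpA_def IHL_def by blast+
  have c: "v a \<in> carrier H" for a using v by (simp add: valuation_def)
  have top: "v a \<in> top_els r H \<longleftrightarrow> (\<forall>w\<in>carrier H. (w, v a) \<in> r)" for a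
    using c by (simp add: maxs_def le_set_def)
  from assms(1) show "v \<phi> \<in> top_els r H"
  proof induction
    case (premise a)
    then show ?case using pr by blast
  next
    case (axiom_instance a)
    then show ?case unfolding top using HCwpA_valuation_axiom[OF H v] by blast
  next
    case (modus_ponens a b)
    have i: "v (Imp a b) \<in> himp H (v a) (v b)" using v by (simp add: valuation_def)
    show ?case
      unfolding top
    proof
      \<comment> \<open>Being designated means lying above every w, so modus ponens is checked at
        each w, with the clause for implication taken at w itself.\<close>
      fix w assume w: "w \<in> carrier H"
      then have "(w, v a) \<in> r" "(w, v (Imp a b)) \<in> r" using modus_ponens.IH by (simp_all add: top)
      then show "(w, v b) \<in> r"
        using IHL_imp_below[OF L i c c w] hyperlattice_refl[OF hl w] w by blast
    qed
  qed
qed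


subsection \<open>Swap structures are hyper algebras\<close>

text \<open>Second components are ignored, so pairs with equal first components are equivalent. This
  matches the binary hyperoperations, which leave the second component free within the
  domain.\<close>

definition swap_rel :: "('a \<times> 'a) set \<Rightarrow> 'a hyperalg_pos \<Rightarrow> (('a \<times> 'a) \<times> 'a \<times> 'a) set" where
  "swap_rel r L = {(z, w) \<in> swap_dom r L \<times> swap_dom r L. (fst z, fst w) \<in> r}"

text \<open>Tops lie above everything, and by transitivity whatever lies above one top is itself a
  top; hence equivalence with the tops amounts to being among them.\<close>

lemma swap_dom_iff:
  assumes L: "IHL r L"
  shows "(x, y) \<in> swap_dom r L \<longleftrightarrow>
    x \<in> carrier L \<and> y \<in> carrier L \<and> hdisj L x y \<subseteq> top_els r L"
proof (cases "x \<in> carrier L \<and> y \<in> carrier L")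
  case True
  have hl: "hyperlattice r L" using L by (simp add: IHL_def)
  obtain t where t: "t \<in> top_els r L" using IHL_top_nonempty[OF L] by blast
  have "(u, t') \<in> r" if "u \<in> hdisj L x y" "t' \<in> top_els r L" for u t'
    using that True hyperlattice_disj_iff[OF hl, of x y] by (simp add: maxs_def le_set_def)
  moreover have "u \<in> top_els r L \<longleftrightarrow> (\<forall>t'\<in>top_els r L. (t', u) \<in> r)"
    if "u \<in> hdisj L x y" for u
  proof -
    have "u \<in> carrier L" using that True hyperlattice_disj_iff[OF hl, of x y] by simp
    then have "u \<in> top_els r L" if "(t, u) \<in> r"
      using t that hyperlattice_trans[OF hl] unfolding maxs_def le_set_def by blast
    then show ?thesis using t by (auto simp: maxs_def le_set_def)
  qed
  ultimately show ?thesis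
    using True unfolding swap_dom_def equiv_set_def equiv_el_def by auto
qed (auto simp: swap_dom_def)

text \<open>Any top element serves as second component, since every join with it is again a top.
  This lets quantifiers over pairs be traded for quantifiers over L.\<close>

lemma swap_dom_first:
  assumes L: "IHL r L" and x: "x \<in> carrier L"
  obtains z where "z \<in> swap_dom r L" "fst z = x"
proof -
  have hl: "hyperlattice r L" using L by (simp add: IHL_def)
  obtain t where t: "t \<in> top_els r L" using IHL_top_nonempty[OF L] by blast
  then have tc: "t \<in> carrier L" by (simp add: maxs_def)
  have "(x, t) \<in> swap_dom r L"
    using t x tc hyperlattice_trans[OF hl] hyperlattice_disj_iff[OF hl x tc]
    unfolding swap_dom_iff[OF L] maxs_def le_set_def by blast
  then show thesis using that by force
qed

lemma HCwpA_swap_alg: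
  assumes L: "IHL r L"
  shows "HCwpA (swap_rel r L) (swap_alg r L)"
proof -
  let ?S = "swap_alg r L" and ?r = "swap_rel r L" and ?D = "swap_dom r L"
  note ops = swap_alg_hyperops[OF L]
  have hl: "hyperlattice r L" using L by (simp add: IHL_def)
  note tr = hyperlattice_trans[OF hl] and rf = hyperlattice_refl[OF hl]
  have car: "carrier ?S = ?D" by (simp add: swap_alg_def)
  have fc: "fst z \<in> carrier L" "snd z \<in> carrier L" if "z \<in> ?D" for z
    using that by (auto simp: swap_dom_def)
  have rel: "(z, w) \<in> ?r \<longleftrightarrow> (fst z, fst w) \<in> r" if "z \<in> ?D" "w \<in> ?D" for z w
    using that by (simp add: swap_rel_def)
  have rel': "(z, w) \<in> ?r \<longleftrightarrow> z \<in> ?D \<and> w \<in> ?D \<and> (fst z, fst w) \<in> r" for z w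
    by (simp add: swap_rel_def)
  \<comment> \<open>Consequently least upper and greatest lower bounds among pairs are those of L
    taken in the first component, which yields \<open>dmin\<close> and \<open>cmax\<close>.\<close>
  have all: "(\<forall>z\<in>?D. P (fst z)) \<longleftrightarrow> (\<forall>x\<in>carrier L. P x)" for P
    using fc swap_dom_first[OF L] by metis
  have po: "preorder_on ?D ?r"
    unfolding preorder_on_def refl_on_def trans_def
    using rf tr fc by (auto simp: swap_rel_def)
  have dis: "u \<in> hdisj ?S z w \<longleftrightarrow> u \<in> ?D \<and> fst u \<in> hdisj L (fst z) (fst w)"
    and con: "u \<in> hconj ?S z w \<longleftrightarrow> u \<in> ?D \<and> fst u \<in> hconj L (fst z) (fst w)"
    and imp: "u \<in> himp ?S z w \<longleftrightarrow> u \<in> ?D \<and> fst u \<in> himp L (fst z) (fst w)"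
    and neg: "u \<in> hneg ?S z \<longleftrightarrow> u \<in> ?D \<and> fst u = snd z \<and> equiv_el r (snd u) (fst z)" for u z w
    by (simp_all add: swap_alg_def)
  have dmin: "hdisj ?S z w = mins ?r (ubs ?D ?r {z, w})" if zw: "z \<in> ?D" "w \<in> ?D" for z w
  proof (rule set_eqI)
    fix u
    have bnd: "x \<in> ubs ?D ?r {z, w} \<longleftrightarrow> x \<in> ?D \<and> (fst z, fst x) \<in> r \<and> (fst w, fst x) \<in> r" for x
      using zw by (simp add: ubs_def le_set_def rel' conj_ac)
    have "u \<in> hdisj ?S z w \<longleftrightarrow> u \<in> ?D \<and> (fst z, fst u) \<in> r \<and> (fst w, fst u) \<in> r \<and>
        (\<forall>x\<in>?D. (fst z, fst x) \<in> r \<longrightarrow> (fst w, fst x) \<in> r \<longrightarrow> (fst u, fst x) \<in> r)"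
      unfolding all[where P = "\<lambda>x. (fst z, x) \<in> r \<longrightarrow> (fst w, x) \<in> r \<longrightarrow> (fst u, x) \<in> r"]
      using zw fc by (simp add: dis hyperlattice_disj_iff[OF hl] cong: conj_cong)
    also have "\<dots> \<longleftrightarrow> u \<in> mins ?r (ubs ?D ?r {z, w})"
      by (simp add: mins_def le_set_def Ball_def bnd rel') blast
    finally show "u \<in> hdisj ?S z w \<longleftrightarrow> u \<in> mins ?r (ubs ?D ?r {z, w})" .
  qed
  have cmax: "hconj ?S z w = maxs ?r (lbs ?D ?r {z, w})" if zw: "z \<in> ?D" "w \<in> ?D" for z w
  proof (rule set_eqI)
    fix u
    have bnd: "x \<in> lbs ?D ?r {z, w} \<longleftrightarrow> x \<in> ?D \<and> (fst x, fst z) \<in> r \<and> (fst x, fst w) \<in> r" for x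
      using zw by (simp add: lbs_def le_set_def rel' conj_ac)
    have "u \<in> hconj ?S z w \<longleftrightarrow> u \<in> ?D \<and> (fst u, fst z) \<in> r \<and> (fst u, fst w) \<in> r \<and>
        (\<forall>x\<in>?D. (fst x, fst z) \<in> r \<longrightarrow> (fst x, fst w) \<in> r \<longrightarrow> (fst x, fst u) \<in> r)"
      unfolding all[where P = "\<lambda>x. (x, fst z) \<in> r \<longrightarrow> (x, fst w) \<in> r \<longrightarrow> (x, fst u) \<in> r"]
      using zw fc by (simp add: con hyperlattice_conj_iff[OF hl] cong: conj_cong)
    also have "\<dots> \<longleftrightarrow> u \<in> maxs ?r (lbs ?D ?r {z, w})"
      by (simp add: maxs_def le_set_def Ball_def bnd rel') blast
    finally show "u \<in> hconj ?S z w \<longleftrightarrow> u \<in> maxs ?r (lbs ?D ?r {z, w})" .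
  qed
  have hlS: "hyperlattice ?r ?S"
    using ops dmin cmax po by (simp add: hyperlattice_def car)
  have res: "(z \<in> himp L x y \<longrightarrow> le_set r (hconj L x z) {y}) \<and>
      (le_set r (hconj L x z) {y} \<longrightarrow> le_set r {z} (himp L x y)) \<and>
      (equiv_el r z z' \<and> z \<in> himp L x y \<longrightarrow> z' \<in> himp L x y)"
    if "x \<in> carrier L" "y \<in> carrier L" "z \<in> carrier L" "z' \<in> carrier L" for x y z z'
    using L[unfolded IHL_def, THEN conjunct2, THEN conjunct2, THEN bspec, THEN bspec, THEN bspec,
      THEN bspec, OF that] .
  have below: "le_set ?r (hconj ?S x z) {y} \<longleftrightarrow> le_set r (hconj L (fst x) (fst z)) {fst y}"
    if "x \<in> ?D" "y \<in> ?D" "z \<in> ?D" for x y z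
  proof -
    have "le_set ?r (hconj ?S x z) {y} \<longleftrightarrow>
        (\<forall>u\<in>?D. fst u \<in> hconj L (fst x) (fst z) \<longrightarrow> (fst u, fst y) \<in> r)"
      using that by (simp add: le_set_def Ball_def con rel') blast
    also have "\<dots> \<longleftrightarrow> le_set r (hconj L (fst x) (fst z)) {fst y}"
      unfolding all[where P = "\<lambda>u. u \<in> hconj L (fst x) (fst z) \<longrightarrow> (u, fst y) \<in> r"]
      using that by (auto simp: le_set_def hyperlattice_conj_iff[OF hl] fc)
    finally show ?thesis .
  qed
  have ihlS: "IHL ?r ?S"
    unfolding IHL_def car
  proof (intro conjI ballI impI hlS)
    show "hyperop2 ?D (himp ?S)" using ops by (simp add: car)
    fix x y z z' assume D: "x \<in> ?D" "y \<in> ?D" "z \<in> ?D" "z' \<in> ?D"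
    note R = res[OF fc(1)[OF D(1)] fc(1)[OF D(2)] fc(1)[OF D(3)] fc(1)[OF D(4)]]
    show "le_set ?r (hconj ?S x z) {y}" if "z \<in> himp ?S x y"
      using that R D by (simp add: below imp)
    show "le_set ?r {z} (himp ?S x y)" if "le_set ?r (hconj ?S x z) {y}"
    proof -
      have "le_set r {fst z} (himp L (fst x) (fst y))" using that R D by (simp add: below)
      then show ?thesis using D by (simp add: le_set_def Ball_def imp rel')
    qed
    show "z' \<in> himp ?S x y" if "equiv_el ?r z z' \<and> z \<in> himp ?S x y"
      using that R D by (simp add: imp equiv_el_def rel)
  qed
  show ?thesis
    unfolding HCwpA_def car
  proof (intro conjI ballI impI ihlS)
    show "hyperop1 ?D (hneg ?S)" using ops by (simp add: car)
    fix x y w assume D: "x \<in> ?D" "y \<in> ?D" "w \<in> ?D"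
    show "w \<in> maxs ?r ?D" if "y \<in> hneg ?S x \<and> w \<in> hdisj ?S x y"
    proof -
      \<comment> \<open>As y is a negation of x, \<open>fst y\<close> is \<open>snd x\<close>, so
        \<open>fst w\<close> lies in the disjunction of the two components of x, which the domain
        condition places among the tops.\<close>
      have "hdisj L (fst x) (snd x) \<subseteq> top_els r L"
        using D(1) swap_dom_iff[OF L, of "fst x" "snd x"] by simp
      then have "fst w \<in> top_els r L" using that by (auto simp: neg dis)
      then show ?thesis using D fc by (auto simp: maxs_def le_set_def car rel)
    qed
    \<comment> \<open>Here \<open>fst w\<close> is \<open>snd y\<close>, which is equivalent to
      \<open>fst x\<close> by the second condition in the negation.\<close>
    show "equiv_el ?r w x" if "y \<in> hneg ?S x \<and> w \<in> hneg ?S y"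
      using that D by (simp add: neg equiv_el_def rel)
  qed
qed

text \<open>Since the first projection maps the domain onto the carrier of L, a pair is above all
  pairs iff its first component is above all of L. Soundness for hyper algebras thereby applies to
  the designated values of the swap Nmatrix.\<close>

lemma top_els_swap_alg:
  assumes L: "IHL r L"
  shows "top_els (swap_rel r L) (swap_alg r L) = swap_desig r L"
proof -
  have "(\<forall>z\<in>swap_dom r L. (fst z, x) \<in> r) \<longleftrightarrow> (\<forall>y\<in>carrier L. (y, x) \<in> r)" for x
    using swap_dom_first[OF L] by (metis (no_types, lifting) mem_Sigma_iff mem_Collect_eq
      prod.collapse swap_dom_def)
  then show ?thesis
    by (auto simp: swap_desig_def swap_rel_def swap_alg_def maxs_def le_set_def swap_dom_def)
qed


subsection \<open>Canonical structures\<close>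

text \<open>The Lindenbaum preorder relative to \<Gamma>, on codes of formulas and without passing
  to the quotient.\<close>

definition canonical_rel :: "fm set \<Rightarrow> (fm \<Rightarrow> 'a) \<Rightarrow> ('a \<times> 'a) set" where
  "canonical_rel \<Gamma> e = {(e a, e b) | a b. \<Gamma> \<turnstile> Imp a b}"

text \<open>The lattice hyperoperations are forced by the order. \<open>himp\<close> is a whole
  equivalence class, as the closure clause of an IHL demands, and \<open>inv e\<close> decodes
  elements of the range of \<open>e\<close>.\<close>

definition canonical_pos :: "fm set \<Rightarrow> (fm \<Rightarrow> 'a) \<Rightarrow> 'a hyperalg_pos" where
  "canonical_pos \<Gamma> e =
     \<lparr> carrier = range e,
       hconj = (\<lambda>x y. maxs (canonical_rel \<Gamma> e) (lbs (range e) (canonical_rel \<Gamma> e) {x, y})),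
       hdisj = (\<lambda>x y. mins (canonical_rel \<Gamma> e) (ubs (range e) (canonical_rel \<Gamma> e) {x, y})),
       himp = (\<lambda>x y. {z. equiv_el (canonical_rel \<Gamma> e) z (e (Imp (inv e x) (inv e y)))}) \<rparr>"

definition canonical_alg :: "fm set \<Rightarrow> (fm \<Rightarrow> 'a) \<Rightarrow> 'a hyperalg" where
  "canonical_alg \<Gamma> e =
     hyperalg_pos.extend (canonical_pos \<Gamma> e) (hyperalg.fields (\<lambda>x. {e (Neg (inv e x))}))"

lemma canonical_alg_sel [simp]:
  "carrier (canonical_alg \<Gamma> e) = carrier (canonical_pos \<Gamma> e)"
  "hconj (canonical_alg \<Gamma> e) = hconj (canonical_pos \<Gamma> e)"
  "hdisj (canonical_alg \<Gamma> e) = hdisj (canonical_pos \<Gamma> e)"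
  "himp (canonical_alg \<Gamma> e) = himp (canonical_pos \<Gamma> e)"
  "hneg (canonical_alg \<Gamma> e) = (\<lambda>x. {e (Neg (inv e x))})"
  by (simp_all add: canonical_alg_def hyperalg_pos.defs hyperalg.defs)

context
  fixes \<Gamma> :: "fm set" and e :: "fm \<Rightarrow> 'a"
  assumes inj_e: "inj e"
begin

lemma canonical_rel_iff [simp]: "(e a, e b) \<in> canonical_rel \<Gamma> e \<longleftrightarrow> \<Gamma> \<turnstile> Imp a b"
  using inj_e by (auto simp: canonical_rel_def inj_eq)

lemma canonical_carrier [simp]: "carrier (canonical_pos \<Gamma> e) = range e"
  by (simp add: canonical_pos_def)

text \<open>Implying both a and b is implying their conjunction, so \<open>And a b\<close> is itself
  a greatest lower bound; comparing with it leaves exactly its equivalents.\<close>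

lemma canonical_conj [simp]:
  "e c \<in> hconj (canonical_pos \<Gamma> e) (e a) (e b) \<longleftrightarrow>
    \<Gamma> \<turnstile> Imp c (And a b) \<and> \<Gamma> \<turnstile> Imp (And a b) c"
proof -
  have "lbs (range e) (canonical_rel \<Gamma> e) {e a, e b} = e ` {d. \<Gamma> \<turnstile> Imp d (And a b)}"
    by (auto simp: lbs_def le_set_def derives_Imp_And)
  then have "e c \<in> hconj (canonical_pos \<Gamma> e) (e a) (e b) \<longleftrightarrow> \<Gamma> \<turnstile> Imp c (And a b) \<and>
      (\<forall>d. \<Gamma> \<turnstile> Imp d (And a b) \<longrightarrow> \<Gamma> \<turnstile> Imp d c)"
    using inj_e by (simp add: canonical_pos_def maxs_def le_set_def inj_image_mem_iff)
  then show ?thesis using derives_Imp_refl derives_Imp_trans by blast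
qed

lemma canonical_disj [simp]:
  "e c \<in> hdisj (canonical_pos \<Gamma> e) (e a) (e b) \<longleftrightarrow>
    \<Gamma> \<turnstile> Imp c (Or a b) \<and> \<Gamma> \<turnstile> Imp (Or a b) c"
proof -
  have "ubs (range e) (canonical_rel \<Gamma> e) {e a, e b} = e ` {d. \<Gamma> \<turnstile> Imp (Or a b) d}"
    by (auto simp: ubs_def le_set_def derives_Or_Imp)
  then have "e c \<in> hdisj (canonical_pos \<Gamma> e) (e a) (e b) \<longleftrightarrow> \<Gamma> \<turnstile> Imp (Or a b) c \<and>
      (\<forall>d. \<Gamma> \<turnstile> Imp (Or a b) d \<longrightarrow> \<Gamma> \<turnstile> Imp c d)"
    using inj_e by (simp add: canonical_pos_def mins_def le_set_def inj_image_mem_iff)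
  then show ?thesis using derives_Imp_refl derives_Imp_trans by blast
qed

lemma canonical_imp [simp]:
  "e c \<in> himp (canonical_pos \<Gamma> e) (e a) (e b) \<longleftrightarrow>
    \<Gamma> \<turnstile> Imp c (Imp a b) \<and> \<Gamma> \<turnstile> Imp (Imp a b) c"
  using inj_e by (simp add: canonical_pos_def equiv_el_def)

lemma canonical_op_subset:
  "hconj (canonical_pos \<Gamma> e) x y \<subseteq> range e"
  "hdisj (canonical_pos \<Gamma> e) x y \<subseteq> range e"
  "himp (canonical_pos \<Gamma> e) x y \<subseteq> range e"
  by (auto simp: canonical_pos_def canonical_rel_def mins_def maxs_def ubs_def lbs_def
      equiv_el_def)

text \<open>A formula implied by every formula is implied by the theorem \<open>Imp a a\<close>,
  hence derivable; K gives the converse. This lets the canonical valuations designate the premises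
  and refute underivable formulas.\<close>

lemma canonical_top:
  "e a \<in> maxs (canonical_rel \<Gamma> e) (range e) \<longleftrightarrow> \<Gamma> \<turnstile> a"
proof -
  have "\<Gamma> \<turnstile> a" if "\<And>b. \<Gamma> \<turnstile> Imp b a"
    using that derives_Imp_refl[of \<Gamma> a] Cwp_derives.modus_ponens by blast
  then show ?thesis by (auto simp: maxs_def le_set_def intro: derives_K)
qed

lemma canonical_hyperops:
  "hyperop2 (range e) (hconj (canonical_pos \<Gamma> e))"
  "hyperop2 (range e) (hdisj (canonical_pos \<Gamma> e))"
  "hyperop2 (range e) (himp (canonical_pos \<Gamma> e))"
proof -
  have "e (And a b) \<in> hconj (canonical_pos \<Gamma> e) (e a) (e b)"
    "e (Or a b) \<in> hdisj (canonical_pos \<Gamma> e) (e a) (e b)"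
    "e (Imp a b) \<in> himp (canonical_pos \<Gamma> e) (e a) (e b)" for a b
    by (simp_all add: derives_Imp_refl)
  then show "hyperop2 (range e) (hconj (canonical_pos \<Gamma> e))"
    "hyperop2 (range e) (hdisj (canonical_pos \<Gamma> e))"
    "hyperop2 (range e) (himp (canonical_pos \<Gamma> e))"
    unfolding hyperop2_def using canonical_op_subset by blast+
qed

lemma canonical_hyperlattice: "hyperlattice (canonical_rel \<Gamma> e) (canonical_pos \<Gamma> e)"
proof -
  have "preorder_on (range e) (canonical_rel \<Gamma> e)"
    unfolding preorder_on_def
  proof (intro conjI)
    show "trans (canonical_rel \<Gamma> e)"
      using inj_e by (auto simp: trans_def canonical_rel_def inj_eq) (blast intro: derives_Imp_trans)
  qed (auto simp: refl_on_def derives_Imp_refl, auto simp: canonical_rel_def)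
  then show ?thesis
    using canonical_hyperops by (simp add: hyperlattice_def) (simp add: canonical_pos_def)
qed

text \<open>All elements of the conjunction are equivalent, so it suffices to test the bound at the
  representative \<open>And a c\<close>.\<close>

lemma canonical_conj_below:
  "le_set (canonical_rel \<Gamma> e) (hconj (canonical_pos \<Gamma> e) (e a) (e c)) {e b} \<longleftrightarrow>
    \<Gamma> \<turnstile> Imp (And a c) b" (is "?l \<longleftrightarrow> ?r")
proof
  assume ?l
  moreover have "e (And a c) \<in> hconj (canonical_pos \<Gamma> e) (e a) (e c)"
    by (simp add: derives_Imp_refl)
  ultimately show ?r by (auto simp: le_set_def simp del: canonical_conj)
next
  assume r: ?r
  have "(x, e b) \<in> canonical_rel \<Gamma> e" if "x \<in> hconj (canonical_pos \<Gamma> e) (e a) (e c)" for x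
  proof -
    obtain d where "x = e d" using canonical_op_subset \<open>x \<in> _\<close> by blast
    then show ?thesis using r that derives_Imp_trans by auto
  qed
  then show ?l by (simp add: le_set_def)
qed

lemma canonical_IHL: "IHL (canonical_rel \<Gamma> e) (canonical_pos \<Gamma> e)"
  unfolding IHL_def canonical_carrier
proof (intro conjI ballI impI canonical_hyperlattice canonical_hyperops)
  fix x y z z' assume "x \<in> range e" "y \<in> range e" "z \<in> range e" "z' \<in> range e"
  then obtain a b c c' where xyz: "x = e a" "y = e b" "z = e c" "z' = e c'" by blast
  show "le_set (canonical_rel \<Gamma> e) (hconj (canonical_pos \<Gamma> e) x z) {y}"
    if "z \<in> himp (canonical_pos \<Gamma> e) x y"
    using that by (simp add: xyz canonical_conj_below derives_residuation)
  show "le_set (canonical_rel \<Gamma> e) {z} (himp (canonical_pos \<Gamma> e) x y)"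
    if "le_set (canonical_rel \<Gamma> e) (hconj (canonical_pos \<Gamma> e) x z) {y}"
  proof -
    have c: "\<Gamma> \<turnstile> Imp c (Imp a b)"
      using that by (simp add: xyz canonical_conj_below derives_residuation)
    have "(z, p) \<in> canonical_rel \<Gamma> e" if "p \<in> himp (canonical_pos \<Gamma> e) x y" for p
    proof -
      obtain d where "p = e d" using canonical_op_subset \<open>p \<in> _\<close> by blast
      then show ?thesis using c \<open>p \<in> _\<close> derives_Imp_trans by (auto simp: xyz)
    qed
    then show ?thesis by (simp add: le_set_def)
  qed
  show "z' \<in> himp (canonical_pos \<Gamma> e) x y"
    if "equiv_el (canonical_rel \<Gamma> e) z z' \<and> z \<in> himp (canonical_pos \<Gamma> e) x y"
    using that by (simp add: xyz equiv_el_def) (meson derives_Imp_trans)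
qed

text \<open>Each member is implied by an instance of excluded middle, hence derivable and a top.
  Both the first negation law of the algebra and the membership of \<open>(e a, e (Neg a))\<close>
  in the swap domain rest on this.\<close>

lemma canonical_disj_Neg:
  "hdisj (canonical_pos \<Gamma> e) (e a) (e (Neg a)) \<subseteq> maxs (canonical_rel \<Gamma> e) (range e)"
proof
  fix w assume w: "w \<in> hdisj (canonical_pos \<Gamma> e) (e a) (e (Neg a))"
  then obtain d where d: "w = e d" using canonical_op_subset by blast
  with w have "\<Gamma> \<turnstile> d"
    by (auto intro: Cwp_derives.modus_ponens[OF derives_excluded_middle])
  then show "w \<in> maxs (canonical_rel \<Gamma> e) (range e)" by (simp add: d canonical_top)
qed

lemma canonical_HCwpA: "HCwpA (canonical_rel \<Gamma> e) (canonical_alg \<Gamma> e)"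
proof -
  \<comment> \<open>The conditions of an IHL mention only the four positive fields, which the
    extension by negation leaves unchanged.\<close>
  have "IHL (canonical_rel \<Gamma> e) (canonical_alg \<Gamma> e)"
    using canonical_IHL unfolding IHL_def hyperlattice_def canonical_alg_sel .
  then show ?thesis
    unfolding HCwpA_def canonical_alg_sel canonical_carrier
  proof (intro conjI ballI impI)
    show "hyperop1 (range e) (\<lambda>x. {e (Neg (inv e x))})" by (simp add: hyperop1_def)
    fix x y w assume "x \<in> range e"
    then obtain a where x: "x = e a" by blast
    show "w \<in> maxs (canonical_rel \<Gamma> e) (range e)"
      if "y \<in> {e (Neg (inv e x))} \<and> w \<in> hdisj (canonical_pos \<Gamma> e) x y"
      using that inj_e canonical_disj_Neg by (auto simp: x)
    show "equiv_el (canonical_rel \<Gamma> e) w x"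
      if "y \<in> {e (Neg (inv e x))} \<and> w \<in> {e (Neg (inv e y))}"
      using that inj_e by (simp add: x equiv_el_def derives_Neg_Neg)
  qed
qed

lemma canonical_valuation: "valuation (canonical_alg \<Gamma> e) e"
  using inj_e by (simp add: valuation_def derives_Imp_refl)

text \<open>The image of \<open>Neg a\<close> has second component \<open>e (Neg (Neg a))\<close>,
  where the swap negation asks only for equivalence with \<open>e a\<close>; the two double negation
  laws supply it.\<close>

lemma canonical_swap_valuation:
  "valuation (swap_alg (canonical_rel \<Gamma> e) (canonical_pos \<Gamma> e)) (\<lambda>a. (e a, e (Neg a)))"
proof -
  have "(e a, e (Neg a)) \<in> swap_dom (canonical_rel \<Gamma> e) (canonical_pos \<Gamma> e)" for a
    using canonical_disj_Neg by (simp add: swap_dom_iff[OF canonical_IHL])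
  then show ?thesis
    by (simp add: valuation_def swap_alg_def equiv_el_def derives_Imp_refl derives_Neg_Neg)
qed

end

section \<open>Completeness over infinite types and the equivalence\<close>

instance fm :: countable
  by countable_datatype

lemma ex_inj_fm:
  assumes "infinite (UNIV :: 'a set)"
  obtains e :: "fm \<Rightarrow> 'a" where "inj e"
proof -
  obtain f :: "nat \<Rightarrow> 'a" where "inj f" using assms infinite_countable_subset by blast
  then have "inj (f \<circ> (to_nat :: fm \<Rightarrow> nat))" by (simp add: inj_compose)
  then show thesis by (rule that)
qed

theorem HCwp_complete:
  assumes "infinite (UNIV :: 'a set)" and "HCwp_conseq TYPE('a) \<Gamma> \<phi>"
  shows "\<Gamma> \<turnstile> \<phi>"
proof -
  obtain e :: "fm \<Rightarrow> 'a" where e: "inj e" using ex_inj_fm assms(1) by blast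
  have "\<forall>\<gamma>\<in>\<Gamma>. e \<gamma> \<in> top_els (canonical_rel \<Gamma> e) (canonical_alg \<Gamma> e)"
    using e by (simp add: canonical_top Cwp_derives.premise)
  then have "e \<phi> \<in> top_els (canonical_rel \<Gamma> e) (canonical_alg \<Gamma> e)"
    using assms(2) canonical_HCwpA[OF e] canonical_valuation[OF e]
    unfolding HCwp_conseq_def nmatrix_conseq_def by blast
  then show ?thesis using e by (simp add: canonical_top)
qed

theorem HSW_complete:
  assumes "infinite (UNIV :: 'b set)" and "HSW_conseq TYPE('b) \<Gamma> \<phi>"
  shows "\<Gamma> \<turnstile> \<phi>"
proof -
  obtain e :: "fm \<Rightarrow> 'b" where e: "inj e" using ex_inj_fm assms(1) by blast
  \<comment> \<open>Within the swap domain, designation inspects the first component, so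
    \<open>canonical_top\<close> decides it.\<close>
  have des: "(e a, e (Neg a)) \<in> swap_desig (canonical_rel \<Gamma> e) (canonical_pos \<Gamma> e) \<longleftrightarrow>
      \<Gamma> \<turnstile> a" for a
    using canonical_swap_valuation[OF e, of \<Gamma>] e
    by (simp add: swap_desig_def canonical_top valuation_def swap_alg_def)
  show ?thesis
    using assms(2) canonical_IHL[OF e, of \<Gamma>] canonical_swap_valuation[OF e, of \<Gamma>] des
      Cwp_derives.premise[of _ \<Gamma>]
    unfolding HSW_conseq_def nmatrix_conseq_def by blast
qed

theorem HSW_sound:
  assumes "\<Gamma> \<turnstile> \<phi>"
  shows "HSW_conseq TYPE('b) \<Gamma> \<phi>"
  unfolding HSW_conseq_def
proof (intro allI impI)
  fix r and L :: "'b hyperalg_pos" assume L: "IHL r L"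
  show "nmatrix_conseq (swap_alg r L) (swap_desig r L) \<Gamma> \<phi>"
    using HCwpA_sound[OF assms HCwpA_swap_alg[OF L]] by (simp add: top_els_swap_alg[OF L])
qed

theorem theorem6p20:
  fixes \<Gamma> :: "fm set" and \<phi> :: fm
  assumes "infinite (UNIV :: 'a set)" and "infinite (UNIV :: 'b set)"
  shows "(\<Gamma> \<turnstile> \<phi> \<longleftrightarrow> HCwp_conseq TYPE('a) \<Gamma> \<phi>) \<and>
         (HCwp_conseq TYPE('a) \<Gamma> \<phi> \<longleftrightarrow> HSW_conseq TYPE('b) \<Gamma> \<phi>)"
proof -
  \<comment> \<open>Each semantic consequence is matched with derivability separately, which allows
    the two kinds of structures to live over different types.\<close>
  have "HCwp_conseq TYPE('a) \<Gamma> \<phi>" if "\<Gamma> \<turnstile> \<phi>"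
    by (simp add: HCwp_conseq_def HCwpA_sound[OF that])
  then show ?thesis
    using assms HCwp_complete HSW_complete HSW_sound by blast
qed

end
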